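(* Let $t_1,\ldots,t_n$ be non-zero complex numbers with $t_n\neq 1$. The representation $\hat{\phi}_G(t_1,\ldots,t_n): Cb_n\to GL_{n-1}(\mathbb{C})$ is irreducible if and only if $t_i\neq 1$ for all $1\le i<n$.
   Context: Let $\mathbb{F}_n$ be the free group on $x_1,\ldots,x_n$. The group $Cb_n$ of basis conjugating automorphisms is the subgroup of $\mathrm{Aut}(\mathbb{F}_n)$ of all automorphisms $\phi$ such that for each $i$, $\phi(x_i)=f_i^{-1}x_if_i$ for some $f_i\in\mathbb{F}_n$. It is generated (McCool) by the automorphisms $\epsilon_{ij}$, $1\le i\ne j\le n$, where $\epsilon_{ij}(x_i)=x_j^{-1}x_ix_j$ and $\epsilon_{ij}(x_l)=x_l$ for $l\ne i$. For non-zero complex numbers $t_1,\ldots,t_n$, let $\hat{\rho}_G:Cb_n\to GL_n(\mathbb{C})$ be the representation such that, for $i\ne j$, $\hat{\rho}_G(\epsilon_{ij})$ is the matrix that agrees with the identity matrix except in row $i$, where the $(i,i)$ entry is $t_j^{-1}$, the $(i,j)$ entry is $t_j^{-1}(t_i-1)$, and all other entries are $0$. The matrices act on column vectors from the left. The vector $v=[t_1-1,\ldots,t_n-1]^T$ is fixed by $\hat{\rho}_G(Cb_n)$. Assume $t_n\ne1$. Then $\{e_1,\ldots,e_{n-1},v\}$ is a basis of $\mathbb{C}^n$ (with $e_k$ the standard basis vectors), and $\hat{\phi}_G=\hat{\phi}_G(t_1,\ldots,t_n)$ is the degree $n-1$ composition factor given by the induced action of $Cb_n$ on $\mathbb{C}^n/\langle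 v\rangle$, written in the basis of the images of $e_1,\ldots,e_{n-1}$ (again denoted $e_k$). Explicitly: - for $i\neq j$ with $i,j\le n-1$: $\epsilon_{ij}(e_i)=t_j^{-1}e_i$, $\epsilon_{ij}(e_j)=e_j+t_j^{-1}(t_i-1)e_i$, and $\epsilon_{ij}(e_k)=e_k$ for $k\ne i,j$; - for $i\le n-1$: $\epsilon_{in}(e_i)=t_n^{-1}e_i$ and $\epsilon_{in}(e_k)=e_k$ for $k\ne i$; - for $j\le n-1$: $\epsilon_{nj}(e_j)=t_j^{-1}e_j-\sum_{1\le k\le n-1,\,k\ne j}t_j^{-1}(t_k-1)e_k$ and $\epsilon_{nj}(e_k)=e_k$ for $k\neq j$. Irreducible means that the only subspaces of the representation space invariant under the whole group are $0$ and the whole space.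
   Formalization: The case n = 2 is excluded: there the representation has degree 1, so it is irreducible even when t_1 = 1 and the claimed equivalence fails (for example t_1 = 1, t_2 = 2). *)

theory Defs
  imports
    "HOL-Algebra.Bij"
    "Jordan_Normal_Form.VS_Connect"
begin

section \<open>Free groups\<close>

text \<open>
  The free group on a set \<open>S\<close> is realised by reduced words. The letter \<open>(a, True)\<close> stands for
  the generator \<open>a\<close> and \<open>(a, False)\<close> for its inverse.
\<close>

type_synonym 'a word = "('a \<times> bool) list"

definition cancels :: "'a \<times> bool \<Rightarrow> 'a \<times> bool \<Rightarrow> bool" where
  "cancels p q \<longleftrightarrow> fst p = fst q \<and> snd p \<noteq> snd q"

definition reduced :: "'a word \<Rightarrow> bool" where
  "reduced w \<longleftrightarrow> successively (\<lambda>p q. \<not> cancels p q) w"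

fun push :: "'a \<times> bool \<Rightarrow> 'a word \<Rightarrow> 'a word" where
  "push p [] = [p]"
| "push p (q # w) = (if cancels p q then w else p # q # w)"

definition free_group :: "'a set \<Rightarrow> 'a word monoid" where
  "free_group S =
    \<lparr>carrier = {w. fst ` set w \<subseteq> S \<and> reduced w}, mult = foldr push, one = []\<rparr>"

definition gen :: "'a \<Rightarrow> 'a word" where
  "gen a = [(a, True)]"

text \<open>The homomorphism out of a free group that sends each generator \<open>a\<close> to \<open>f a\<close>.\<close>

definition lift_free :: "('g, 'c) monoid_scheme \<Rightarrow> ('a \<Rightarrow> 'g) \<Rightarrow> 'a word \<Rightarrow> 'g" where
  "lift_free G f w =
    foldr (\<lambda>(a, b) y. (if b then f a else inv\<^bsub>G\<^esub> (f a)) \<otimes>\<^bsub>G\<^esub> y) w \<one>\<^bsub>G\<^esub>"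

lemma reduced_Nil [simp]: "reduced []"
  by (simp add: reduced_def)

lemma reduced_Cons: "reduced (p # w) \<longleftrightarrow> (w = [] \<or> \<not> cancels p (hd w)) \<and> reduced w"
  by (cases w) (auto simp: reduced_def)

lemma reduced_push: "reduced w \<Longrightarrow> reduced (push p w)"
  by (cases w) (auto simp: reduced_Cons)

lemma reduced_foldr_push: "reduced v \<Longrightarrow> reduced (foldr push u v)"
  by (induction u) (auto simp: reduced_push)

lemma set_push: "set (push p w) \<subseteq> insert p (set w)"
  by (cases w) auto

lemma set_foldr_push: "set (foldr push u v) \<subseteq> set u \<union> set v"
  by (induction u) (use set_push in fastforce)+

lemma push_cancel: "reduced w \<Longrightarrow> cancels p q \<Longrightarrow> push p (push q w) = w"
proof (cases w)
  case (Cons r v)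
  assume "reduced w" "cancels p q"
  then show ?thesis using Cons
    by (cases v; cases p; cases q; cases r) (auto simp: cancels_def reduced_Cons)
qed auto

lemma foldr_push_Nil: "reduced u \<Longrightarrow> foldr push u [] = u"
proof (induction u)
  case (Cons p u)
  then show ?case by (cases u) (auto simp: reduced_Cons)
qed simp

lemma foldr_push_push: "reduced w \<Longrightarrow> foldr push (push p x) w = push p (foldr push x w)"
  by (cases x) (auto simp: push_cancel reduced_foldr_push)

lemma foldr_push_assoc:
  "reduced w \<Longrightarrow> foldr push (foldr push u v) w = foldr push u (foldr push v w)"
  by (induction u) (auto simp: foldr_push_push)

lemma foldr_push_inverse:
  "reduced w \<Longrightarrow> foldr push (rev (map (\<lambda>(a, b). (a, \<not> b)) u)) (foldr push u w) = w"
proof (induction u arbitrary: w)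
  case (Cons p u)
  then show ?case
    by (cases p) (simp add: push_cancel cancels_def reduced_foldr_push)
qed simp

lemma reduced_inverse: "reduced u \<Longrightarrow> reduced (rev (map (\<lambda>(a, b). (a, \<not> b)) u))"
  by (auto simp: reduced_def successively_rev successively_map cancels_def
      elim!: successively_mono split: prod.splits)

lemma group_free_group: "group (free_group S)"
proof (rule groupI)
  fix u assume u: "u \<in> carrier (free_group S)"
  let ?v = "rev (map (\<lambda>(a, b). (a, \<not> b)) u)"
  have "foldr push ?v u = []"
    using foldr_push_inverse[of "[]" u] u by (simp add: free_group_def foldr_push_Nil)
  moreover have "?v \<in> carrier (free_group S)"
    using u by (auto simp: free_group_def reduced_inverse)
  ultimately show "\<exists>v\<in>carrier (free_group S). v \<otimes>\<^bsub>free_group S\<^esub> u = \<one>\<^bsub>free_group S\<^esub>"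
    by (intro bexI[of _ ?v]) (simp_all add: free_group_def)
next
  fix u v assume "u \<in> carrier (free_group S)" "v \<in> carrier (free_group S)"
  then show "u \<otimes>\<^bsub>free_group S\<^esub> v \<in> carrier (free_group S)"
    using set_foldr_push[of u v] by (fastforce simp: free_group_def reduced_foldr_push)
qed (auto simp: free_group_def foldr_push_assoc)

lemma gen_closed: "a \<in> S \<Longrightarrow> gen a \<in> carrier (free_group S)"
  by (auto simp: free_group_def gen_def reduced_Cons)

lemma inv_gen: "a \<in> S \<Longrightarrow> inv\<^bsub>free_group S\<^esub> (gen a) = [(a, False)]"
  by (rule group.inv_equality[OF group_free_group])
     (auto simp: free_group_def gen_def reduced_Cons cancels_def)

lemma (in group) lift_free_closed:
  "f \<in> S \<rightarrow> carrier G \<Longrightarrow> fst ` set w \<subseteq> S \<Longrightarrow> lift_free G f w \<in> carrier G"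
  by (induction w) (auto simp: lift_free_def Pi_iff)

lemma (in group) lift_free_push:
  assumes "f \<in> S \<rightarrow> carrier G" "fst ` set w \<subseteq> S" "fst p \<in> S"
  shows "lift_free G f (push p w) =
    (if snd p then f (fst p) else inv (f (fst p))) \<otimes> lift_free G f w"
proof (cases w)
  case Nil
  then show ?thesis by (cases p) (simp add: lift_free_def)
next
  case (Cons q v)
  obtain a b where p: "p = (a, b)" by force
  obtain c d where q: "q = (c, d)" by force
  have f: "f a \<in> carrier G" "f c \<in> carrier G" using assms p q Cons by auto
  have v: "lift_free G f v \<in> carrier G"
    using assms Cons by (intro lift_free_closed) auto
  have qv: "lift_free G f (q # v) = (if d then f c else inv (f c)) \<otimes> lift_free G f v"
    by (simp add: lift_free_def q)
  show ?thesis
  proof (cases "cancels p q")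
    case True
    then have "c = a" "d = (\<not> b)" by (auto simp: cancels_def p q)
    then show ?thesis using True qv v f Cons p
      by (simp add: m_assoc[symmetric])
  next
    case False
    then show ?thesis by (simp add: Cons lift_free_def p)
  qed
qed

lemma (in group) lift_free_hom:
  assumes f: "f \<in> S \<rightarrow> carrier G"
  shows "lift_free G f \<in> hom (free_group S) G"
proof (rule homI)
  fix u v assume u: "u \<in> carrier (free_group S)" and v: "v \<in> carrier (free_group S)"
  have "fst ` set u \<subseteq> S" using u by (simp add: free_group_def)
  then have "lift_free G f (foldr push u v) = lift_free G f u \<otimes> lift_free G f v"
  proof (induction u)
    case Nil
    show ?case using v lift_free_closed[OF f, of v] by (simp add: lift_free_def free_group_def)
  next
    case (Cons p u)
    have "fst ` set (foldr push u v) \<subseteq> S"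
      using set_foldr_push[of u v] Cons.prems v by (fastforce simp: free_group_def)
    then have "lift_free G f (foldr push (p # u) v) =
      (if snd p then f (fst p) else inv (f (fst p))) \<otimes> lift_free G f (foldr push u v)"
      using Cons.prems lift_free_push[OF f] by auto
    also have "\<dots> = lift_free G f (p # u) \<otimes> lift_free G f v"
      using Cons f v lift_free_closed[OF f, of u] lift_free_closed[OF f, of v]
      by (cases p) (auto simp: lift_free_def free_group_def m_assoc Pi_iff)
    finally show ?case .
  qed
  then show "lift_free G f (u \<otimes>\<^bsub>free_group S\<^esub> v) = lift_free G f u \<otimes> lift_free G f v"
    by (simp add: free_group_def)
qed (use lift_free_closed[OF f] in \<open>auto simp: free_group_def\<close>)

lemma (in group) lift_free_gen: "f a \<in> carrier G \<Longrightarrow> lift_free G f (gen a) = f a"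
  by (simp add: lift_free_def gen_def)

lemma (in group) hom_free_group_eqI:
  assumes g: "g \<in> hom (free_group S) G" and h: "h \<in> hom (free_group S) G"
    and eq: "\<And>a. a \<in> S \<Longrightarrow> g (gen a) = h (gen a)" and w: "w \<in> carrier (free_group S)"
  shows "g w = h w"
  using w
proof (induction w)
  case Nil
  show ?case
    using hom_one[OF g group_free_group is_group] hom_one[OF h group_free_group is_group]
    by (simp add: free_group_def)
next
  case (Cons p w)
  obtain a b where p: "p = (a, b)" by force
  have a: "a \<in> S" and w: "w \<in> carrier (free_group S)"
    and pw: "push p w = p # w"
    using Cons.prems by (cases w; auto simp: free_group_def reduced_Cons p)+
  have pc: "[p] \<in> carrier (free_group S)" using a by (simp add: free_group_def p reduced_Cons)
  interpret gh: group_hom "free_group S" G g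
    using g by (auto simp: group_hom_def group_hom_axioms_def group_free_group)
  interpret hh: group_hom "free_group S" G h
    using h by (auto simp: group_hom_def group_hom_axioms_def group_free_group)
  have "g [p] = h [p]"
  proof (cases b)
    case True
    then show ?thesis using eq[OF a] by (simp add: p gen_def)
  next
    case False
    then show ?thesis
      using gh.hom_inv[OF gen_closed[OF a]] hh.hom_inv[OF gen_closed[OF a]] eq[OF a]
      by (simp add: p inv_gen[OF a])
  qed
  moreover have "p # w = [p] \<otimes>\<^bsub>free_group S\<^esub> w" using pw by (simp add: free_group_def)
  ultimately show ?case
    using gh.hom_mult[OF pc w] hh.hom_mult[OF pc w] Cons.IH[OF w] by simp
qed


section \<open>Basis conjugating automorphisms\<close>

text \<open>
  Indices are counted from \<open>0\<close>: the generators \<open>x\<^sub>1, \<dots>, x\<^sub>n\<close> are \<open>gen 0, \<dots>, gen (n - 1)\<close>, and the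
  parameters \<open>t\<^sub>1, \<dots>, t\<^sub>n\<close> are \<open>t 0, \<dots>, t (n - 1)\<close>.
\<close>

abbreviation Fn :: "nat \<Rightarrow> nat word monoid" where
  "Fn n \<equiv> free_group {..<n}"

text \<open>
  Elements are functions that are \<open>undefined\<close> outside the carrier of \<open>Fn n\<close>; the product
  \<open>\<phi> \<otimes> \<psi>\<close> is the composition that applies \<open>\<psi>\<close> first.
\<close>

definition Cb :: "nat \<Rightarrow> (nat word \<Rightarrow> nat word) monoid" where
  "Cb n = AutoGroup (Fn n)
    \<lparr>carrier := {\<phi> \<in> carrier (AutoGroup (Fn n)).
       \<forall>i<n. \<exists>f\<in>carrier (Fn n).
         \<phi> (gen i) = inv\<^bsub>Fn n\<^esub> f \<otimes>\<^bsub>Fn n\<^esub> gen i \<otimes>\<^bsub>Fn n\<^esub> f}\<rparr>"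

definition eps :: "nat \<Rightarrow> nat \<Rightarrow> nat \<Rightarrow> nat word \<Rightarrow> nat word" where
  "eps n i j = (\<lambda>w \<in> carrier (Fn n). lift_free (Fn n)
     (\<lambda>l. if l = i then inv\<^bsub>Fn n\<^esub> (gen j) \<otimes>\<^bsub>Fn n\<^esub> gen i \<otimes>\<^bsub>Fn n\<^esub> gen j else gen l) w)"

lemma carrier_Cb:
  "\<phi> \<in> carrier (Cb n) \<longleftrightarrow> \<phi> \<in> hom (Fn n) (Fn n) \<and> \<phi> \<in> Bij (carrier (Fn n)) \<and>
    (\<forall>i<n. \<exists>f\<in>carrier (Fn n). \<phi> (gen i) = inv\<^bsub>Fn n\<^esub> f \<otimes>\<^bsub>Fn n\<^esub> gen i \<otimes>\<^bsub>Fn n\<^esub> f)"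
  by (auto simp: Cb_def AutoGroup_def auto_def)

lemma mult_Cb:
  assumes "\<phi> \<in> carrier (Cb n)" "\<psi> \<in> carrier (Cb n)"
  shows "\<phi> \<otimes>\<^bsub>Cb n\<^esub> \<psi> = compose (carrier (Fn n)) \<phi> \<psi>"
  using assms by (simp add: carrier_Cb) (simp add: Cb_def AutoGroup_def BijGroup_def)

lemma group_Cb: "group (Cb n)"
proof -
  interpret group "Fn n" by (rule group_free_group)
  let ?F = "Fn n" and ?C = "carrier (Fn n)" and ?A = "AutoGroup (Fn n)"
  interpret A: group ?A by (rule AutoGroup)
  have A: "\<phi> \<in> carrier ?A \<longleftrightarrow> \<phi> \<in> hom ?F ?F \<and> \<phi> \<in> Bij ?C" for \<phi>
    by (simp add: AutoGroup_def auto_def)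
  have one: "\<one>\<^bsub>?A\<^esub> = (\<lambda>x\<in>?C. x)"
    by (simp add: AutoGroup_def BijGroup_def)
  have mult: "\<phi> \<otimes>\<^bsub>?A\<^esub> \<psi> = compose ?C \<phi> \<psi>" if "\<phi> \<in> carrier ?A" "\<psi> \<in> carrier ?A" for \<phi> \<psi>
    using that by (simp add: A) (simp add: AutoGroup_def BijGroup_def)
  have gc [simp]: "gen l \<in> ?C" if "l < n" for l using that by (auto intro: gen_closed)
  have "subgroup (carrier (Cb n)) ?A"
  proof (rule A.subgroupI)
    show "carrier (Cb n) \<subseteq> carrier ?A"
      by (auto simp: Cb_def)
    have "\<one>\<^bsub>?A\<^esub> \<in> carrier (Cb n)"
      using A.one_closed by (auto simp: carrier_Cb A) (auto simp: one intro!: bexI[of _ "\<one>\<^bsub>?F\<^esub>"])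
    then show "carrier (Cb n) \<noteq> {}" by blast
  next
    fix \<phi> assume \<phi>: "\<phi> \<in> carrier (Cb n)"
    then have \<phi>A: "\<phi> \<in> carrier ?A" by (simp add: carrier_Cb A)
    define \<psi> where "\<psi> = inv\<^bsub>?A\<^esub> \<phi>"
    have \<psi>A: "\<psi> \<in> carrier ?A" using \<phi>A by (simp add: \<psi>_def)
    then interpret \<psi>: group_hom ?F ?F \<psi> by unfold_locales (simp add: A)
    have "\<psi> \<otimes>\<^bsub>?A\<^esub> \<phi> = \<one>\<^bsub>?A\<^esub>" using \<phi>A by (simp add: \<psi>_def)
    then have \<psi>\<phi>: "\<psi> (\<phi> x) = x" if "x \<in> ?C" for x
      using that by (metis mult[OF \<psi>A \<phi>A] one compose_eq restrict_apply')
    have "\<exists>h\<in>?C. \<psi> (gen i) = inv\<^bsub>?F\<^esub> h \<otimes>\<^bsub>?F\<^esub> gen i \<otimes>\<^bsub>?F\<^esub> h" if i: "i < n" for i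
    proof -
      obtain f where f: "f \<in> ?C" "\<phi> (gen i) = inv\<^bsub>?F\<^esub> f \<otimes>\<^bsub>?F\<^esub> gen i \<otimes>\<^bsub>?F\<^esub> f"
        using \<phi> i by (auto simp: carrier_Cb)
      have "gen i = inv\<^bsub>?F\<^esub> (\<psi> f) \<otimes>\<^bsub>?F\<^esub> \<psi> (gen i) \<otimes>\<^bsub>?F\<^esub> \<psi> f"
        using \<psi>\<phi>[of "gen i"] f i by simp
      then have "\<psi> (gen i) = \<psi> f \<otimes>\<^bsub>?F\<^esub> gen i \<otimes>\<^bsub>?F\<^esub> inv\<^bsub>?F\<^esub> (\<psi> f)"
        using f i by (metis gc \<psi>.hom_closed inv_closed inv_solve_left inv_solve_right m_assoc m_closed)
      then show ?thesis
        using f by (intro bexI[of _ "inv\<^bsub>?F\<^esub> (\<psi> f)"]) auto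
    qed
    then show "inv\<^bsub>?A\<^esub> \<phi> \<in> carrier (Cb n)"
      using \<psi>A by (simp add: carrier_Cb A \<psi>_def)
  next
    fix \<phi> \<psi> assume \<phi>: "\<phi> \<in> carrier (Cb n)" and \<psi>: "\<psi> \<in> carrier (Cb n)"
    then have AA: "\<phi> \<in> carrier ?A" "\<psi> \<in> carrier ?A" by (simp_all add: carrier_Cb A)
    then interpret \<phi>: group_hom ?F ?F \<phi> by unfold_locales (simp add: A)
    have "\<exists>h\<in>?C. (\<phi> \<otimes>\<^bsub>?A\<^esub> \<psi>) (gen i) = inv\<^bsub>?F\<^esub> h \<otimes>\<^bsub>?F\<^esub> gen i \<otimes>\<^bsub>?F\<^esub> h" if i: "i < n" for i
    proof -
      obtain f where f: "f \<in> ?C" "\<phi> (gen i) = inv\<^bsub>?F\<^esub> f \<otimes>\<^bsub>?F\<^esub> gen i \<otimes>\<^bsub>?F\<^esub> f"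
        using \<phi> i by (auto simp: carrier_Cb)
      obtain g where g: "g \<in> ?C" "\<psi> (gen i) = inv\<^bsub>?F\<^esub> g \<otimes>\<^bsub>?F\<^esub> gen i \<otimes>\<^bsub>?F\<^esub> g"
        using \<psi> i by (auto simp: carrier_Cb)
      show ?thesis
        using f g i
        by (intro bexI[of _ "f \<otimes>\<^bsub>?F\<^esub> \<phi> g"]) (simp_all add: mult[OF AA] compose_eq inv_mult_group m_assoc)
    qed
    then show "\<phi> \<otimes>\<^bsub>?A\<^esub> \<psi> \<in> carrier (Cb n)"
      using A.m_closed[OF AA] by (simp add: carrier_Cb A)
  qed
  then have "group (?A\<lparr>carrier := carrier (Cb n)\<rparr>)"
    by (rule A.subgroup_imp_group)
  then show ?thesis by (simp add: Cb_def)
qed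

lemma eps_gen:
  assumes "i < n" "j < n" "l < n"
  shows "eps n i j (gen l) =
    (if l = i then inv\<^bsub>Fn n\<^esub> (gen j) \<otimes>\<^bsub>Fn n\<^esub> gen i \<otimes>\<^bsub>Fn n\<^esub> gen j else gen l)"
proof -
  interpret group "Fn n" by (rule group_free_group)
  have "gen i \<in> carrier (Fn n)" "gen j \<in> carrier (Fn n)" "gen l \<in> carrier (Fn n)"
    using assms by (auto intro: gen_closed)
  then show ?thesis
    by (auto simp: eps_def intro!: trans[OF lift_free_gen])
qed

lemma eps_in_Cb:
  assumes ij: "i < n" "j < n" "i \<noteq> j"
  shows "eps n i j \<in> carrier (Cb n)"
proof -
  interpret group "Fn n" by (rule group_free_group)
  let ?F = "Fn n" and ?C = "carrier (Fn n)"
  have gc [simp]: "gen l \<in> ?C" if "l < n" for l using that by (auto intro: gen_closed)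
  note [simp] = ij
  define f where "f l = (if l = i then inv\<^bsub>?F\<^esub> (gen j) \<otimes>\<^bsub>?F\<^esub> gen i \<otimes>\<^bsub>?F\<^esub> gen j else gen l)" for l
  define g where "g l = (if l = i then gen j \<otimes>\<^bsub>?F\<^esub> gen i \<otimes>\<^bsub>?F\<^esub> inv\<^bsub>?F\<^esub> (gen j) else gen l)" for l
  have fc: "f \<in> {..<n} \<rightarrow> ?C" and gg: "g \<in> {..<n} \<rightarrow> ?C"
    by (auto simp: f_def g_def)
  let ?f = "lift_free ?F f" and ?g = "lift_free ?F g"
  have fh: "?f \<in> hom ?F ?F" and gh: "?g \<in> hom ?F ?F"
    using lift_free_hom[OF fc] lift_free_hom[OF gg] by auto
  interpret fh: group_hom ?F ?F ?f using fh by unfold_locales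
  interpret gh: group_hom ?F ?F ?g using gh by unfold_locales
  have fgen: "?f (gen l) = f l" "?g (gen l) = g l" if "l < n" for l
    using fc gg that by (auto intro!: lift_free_gen)
  have gj: "gen j \<otimes>\<^bsub>?F\<^esub> (inv\<^bsub>?F\<^esub> (gen j) \<otimes>\<^bsub>?F\<^esub> x) = x" if "x \<in> ?C" for x
    using that by (simp add: m_assoc[symmetric])
  have "(?g \<circ> ?f) w = id w" if "w \<in> ?C" for w
  proof (rule hom_free_group_eqI[of "?g \<circ> ?f" "{..<n}" id])
    show "(?g \<circ> ?f) (gen a) = id (gen a)" if "a \<in> {..<n}" for a
      using that by (auto simp: fgen f_def g_def m_assoc inv_solve_left')
  qed (use that fh gh in \<open>auto simp: hom_compose hom_def\<close>)
  moreover have "(?f \<circ> ?g) w = id w" if "w \<in> ?C" for w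
  proof (rule hom_free_group_eqI[of "?f \<circ> ?g" "{..<n}" id])
    show "(?f \<circ> ?g) (gen a) = id (gen a)" if "a \<in> {..<n}" for a
      using that by (auto simp: fgen f_def g_def m_assoc gj)
  qed (use that fh gh in \<open>auto simp: hom_compose hom_def\<close>)
  ultimately have "bij_betw ?f ?C ?C"
    by (intro bij_betw_byWitness[where f' = ?g]) auto
  moreover have eps: "eps n i j = restrict ?f ?C"
    by (simp add: eps_def f_def[abs_def])
  ultimately have "eps n i j \<in> Bij ?C"
    by (auto simp: Bij_def cong: bij_betw_cong)
  moreover have "eps n i j \<in> hom ?F ?F"
    by (auto simp: eps hom_def)
  moreover have "\<exists>h\<in>?C. eps n i j (gen l) = inv\<^bsub>?F\<^esub> h \<otimes>\<^bsub>?F\<^esub> gen l \<otimes>\<^bsub>?F\<^esub> h" if "l < n" for l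
    by (rule bexI[of _ "if l = i then gen j else \<one>\<^bsub>?F\<^esub>"]) (use that in \<open>auto simp: eps_gen\<close>)
  ultimately show ?thesis by (auto simp: carrier_Cb)
qed


section \<open>The representations\<close>

abbreviation GL :: "nat \<Rightarrow> complex mat monoid" where
  "GL d \<equiv> units_of (ring_mat TYPE(complex) d ())"

definition gassner_mat :: "nat \<Rightarrow> (nat \<Rightarrow> complex) \<Rightarrow> nat \<Rightarrow> nat \<Rightarrow> complex mat" where
  "gassner_mat n t i j = mat n n (\<lambda>(r, c).
     if r = i then
       (if c = i then inverse (t j)
        else if c = j then inverse (t j) * (t i - 1)
        else 0)
     else if r = c then 1 else 0)"

definition fixed_vec :: "nat \<Rightarrow> (nat \<Rightarrow> complex) \<Rightarrow> complex vec" where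
  "fixed_vec n t = vec n (\<lambda>i. t i - 1)"

text \<open>
  Coordinates of the class of \<open>w\<close> in the quotient by the span of \<open>v = fixed_vec n t\<close>, with respect to
  the images of all standard basis vectors but the last one: subtract the multiple of \<open>v\<close> that
  makes the last coordinate vanish. This needs \<open>t (n - 1) \<noteq> 1\<close>; see \<open>quot_coords_unique\<close>.
\<close>

definition quot_coords :: "nat \<Rightarrow> (nat \<Rightarrow> complex) \<Rightarrow> complex vec \<Rightarrow> complex vec" where
  "quot_coords n t w = vec (n - 1)
     (\<lambda>k. (w - (w $ (n - 1) / fixed_vec n t $ (n - 1)) \<cdot>\<^sub>v fixed_vec n t) $ k)"

text \<open>
  The action on the quotient induced by \<open>\<rho>\<close>, as a matrix in this basis: column \<open>k\<close> holds the
  coordinates of the image of the class of the \<open>k\<close>-th standard basis vector.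
\<close>

definition gassner_factor ::
  "nat \<Rightarrow> (nat \<Rightarrow> complex) \<Rightarrow> ('g \<Rightarrow> complex mat) \<Rightarrow> 'g \<Rightarrow> complex mat" where
  "gassner_factor n t \<rho> g = mat_of_cols (n - 1)
     (map (\<lambda>k. quot_coords n t (\<rho> g *\<^sub>v unit_vec n k)) [0..<n - 1])"

definition irreducible_rep ::
  "('g, 'c) monoid_scheme \<Rightarrow> nat \<Rightarrow> ('g \<Rightarrow> complex mat) \<Rightarrow> bool" where
  "irreducible_rep G d \<phi> \<longleftrightarrow>
    (\<forall>W. subspace class_ring W (module_vec TYPE(complex) d) \<longrightarrow>
         (\<forall>g\<in>carrier G. \<forall>w\<in>W. \<phi> g *\<^sub>v w \<in> W) \<longrightarrow>
         W = {0\<^sub>v d} \<or> W = carrier_vec d)"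

lemma quot_coords_unique:
  assumes "0 < n" "t (n - 1) \<noteq> 1" and w: "w \<in> carrier_vec n" and a: "a \<in> carrier_vec (n - 1)"
  shows "a = quot_coords n t w \<longleftrightarrow>
    (\<exists>c. w = vec n (\<lambda>k. if k < n - 1 then a $ k else 0) + c \<cdot>\<^sub>v fixed_vec n t)"
proof
  assume "a = quot_coords n t w"
  then have "w = vec n (\<lambda>k. if k < n - 1 then a $ k else 0)
      + (w $ (n - 1) / fixed_vec n t $ (n - 1)) \<cdot>\<^sub>v fixed_vec n t"
    using assms by (intro eq_vecI) (auto simp: quot_coords_def fixed_vec_def not_less dest!: le_antisym)
  then show "\<exists>c. w = vec n (\<lambda>k. if k < n - 1 then a $ k else 0) + c \<cdot>\<^sub>v fixed_vec n t" ..
next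
  assume "\<exists>c. w = vec n (\<lambda>k. if k < n - 1 then a $ k else 0) + c \<cdot>\<^sub>v fixed_vec n t"
  then obtain c where c: "w = vec n (\<lambda>k. if k < n - 1 then a $ k else 0) + c \<cdot>\<^sub>v fixed_vec n t" ..
  have "w $ (n - 1) = c * (t (n - 1) - 1)"
    using assms by (simp add: c fixed_vec_def)
  then show "a = quot_coords n t w"
    using assms by (intro eq_vecI) (auto simp: c quot_coords_def fixed_vec_def)
qed

lemma gassner_mat_fixes:
  assumes "i < n" "j < n" "i \<noteq> j" "t j \<noteq> 0"
  shows "gassner_mat n t i j *\<^sub>v fixed_vec n t = fixed_vec n t"
proof (rule eq_vecI)
  fix r assume "r < dim_vec (fixed_vec n t)"
  then have r: "r < n" by (simp add: fixed_vec_def)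
  have "(gassner_mat n t i j *\<^sub>v fixed_vec n t) $ r =
      (\<Sum>c<n. gassner_mat n t i j $$ (r, c) * (t c - 1))"
    using r by (simp add: fixed_vec_def scalar_prod_def gassner_mat_def lessThan_atLeast0)
  also have "\<dots> = (\<Sum>c<n. if r = i then
        (if c = i then inverse (t j) * (t i - 1) else 0)
        + (if c = j then inverse (t j) * (t i - 1) * (t j - 1) else 0)
      else if c = r then t r - 1 else 0)"
    using r assms by (intro sum.cong) (auto simp: gassner_mat_def)
  also have "\<dots> = t r - 1"
    using r assms by (cases "r = i") (auto simp: sum.distrib field_simps)
  finally show "(gassner_mat n t i j *\<^sub>v fixed_vec n t) $ r = fixed_vec n t $ r"
    using r by (simp add: fixed_vec_def)
qed (simp add: fixed_vec_def gassner_mat_def)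

lemma gassner_factor_index:
  assumes "\<rho> g = A" "A \<in> carrier_mat n n" "r < n - 1" "c < n - 1"
  shows "gassner_factor n t \<rho> g $$ (r, c) =
    A $$ (r, c) - A $$ (n - 1, c) / (t (n - 1) - 1) * (t r - 1)"
  using assms
  by (simp add: gassner_factor_def mat_of_cols_def quot_coords_def fixed_vec_def)

lemma gassner_factor_eps:
  assumes "i < n" "j < n" "i \<noteq> j" "t (n - 1) \<noteq> 1" "t j \<noteq> 0" "\<rho> (eps n i j) = gassner_mat n t i j"
    and rc: "r < n - 1" "c < n - 1"
  shows "gassner_factor n t \<rho> (eps n i j) $$ (r, c) =
    (if i < n - 1 \<and> j < n - 1 then
       (if r = i \<and> c = i then inverse (t j)
        else if r = i \<and> c = j then inverse (t j) * (t i - 1)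
        else if r = c then 1 else 0)
     else if i < n - 1 then
       (if r = i \<and> c = i then inverse (t (n - 1)) else if r = c then 1 else 0)
     else
       (if c = j then (if r = j then inverse (t j) else - inverse (t j) * (t r - 1))
        else if r = c then 1 else 0))"
proof -
  have A: "gassner_mat n t i j \<in> carrier_mat n n" by (simp add: gassner_mat_def)
  have n: "n - 1 < n" "c < n" "r < n" "n - 1 \<noteq> c" using rc by auto
  have "gassner_factor n t \<rho> (eps n i j) $$ (r, c) = gassner_mat n t i j $$ (r, c)
      - gassner_mat n t i j $$ (n - 1, c) / (t (n - 1) - 1) * (t r - 1)"
    by (rule gassner_factor_index[where \<rho> = \<rho>, OF assms(6) A rc])
  moreover have "i < n - 1 \<or> i = n - 1" "j < n - 1 \<or> j = n - 1" using assms(1,2) by auto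
  moreover have "1 - inverse (t j) * (t j - 1) = inverse (t j)"
    using assms(5) by (simp add: field_simps)
  ultimately show ?thesis
    using n rc assms(3-5) by (elim disjE) (auto simp: gassner_mat_def)
qed

end

theory Submission
  imports Defs "HOL-Algebra.Generated_Groups"
begin

text \<open>
  Write \<open>d = n - 1\<close>, the dimension of the factor and also the index of the last generator.

  Suppose all \<open>t i \<noteq> 1\<close>, and let \<open>W\<close> be an invariant subspace with a vector \<open>w\<close> whose \<open>i\<close>-th
  coordinate is nonzero. On the quotient, \<open>eps n i d - 1\<close> kills every basis vector except \<open>e i\<close>,
  which it scales by \<open>1 / t d - 1 \<noteq> 0\<close>; so \<open>e i \<in> W\<close>. For \<open>j \<noteq> i\<close> the image of \<open>e i\<close> under
  \<open>eps n j i\<close> has \<open>j\<close>-th coordinate \<open>(t j - 1) / t i \<noteq> 0\<close>; so \<open>e j \<in> W\<close> by the same argument, and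
  \<open>W\<close> is the whole space.

  Conversely, if \<open>t i = 1\<close> for some \<open>i < d\<close>, then in every matrix \<open>gassner_mat n t k l\<close> the \<open>i\<close>-th row
  vanishes off the diagonal. This property passes to products and inverses, and
  then from \<open>\<rho> g\<close> to the matrix of \<open>g\<close> on the quotient, because the \<open>i\<close>-th coordinate of the fixed
  vector is \<open>t i - 1 = 0\<close>. Hence the hyperplane of vectors with vanishing \<open>i\<close>-th coordinate is
  invariant. It is a proper subspace, and it is nonzero because \<open>d > 1\<close>.

  The second argument concerns all elements of \<open>Cb n\<close> although \<open>\<rho>\<close> is only known on the \<open>eps n i j\<close>,
  so it rests on McCool's theorem that these generate \<open>Cb n\<close> (\<open>Cb_generated_by_eps\<close>). That theorem
  is proved by cancellation in the style of Nielsen. Let \<open>\<phi>\<close> send each generator \<open>x i\<close> to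
  \<open>inverse (f i) * x i * f i\<close>, with \<open>f i\<close> reduced and not beginning with \<open>x i\<close> or its inverse. If some
  \<open>f j\<close> ends with a letter \<open>x i\<close> or its inverse followed by \<open>f i\<close>, where \<open>i \<noteq> j\<close>, then composing \<open>\<phi>\<close>
  with \<open>eps n j i\<close> or its inverse removes that letter, and the total length of the \<open>f i\<close> decreases.
  If this never happens, the central letter of each factor survives when the value of \<open>\<phi>\<close> on a
  reduced word is multiplied out (\<open>central_letters_survive\<close>). As \<open>\<phi>\<close> is surjective, it takes the value
  \<open>x i\<close>, which forces \<open>f i\<close> to be empty; thus \<open>\<phi>\<close> is the identity.
\<close>

section \<open>Normal forms in the free group\<close>

text \<open>
  Products in the free group are computed as normal forms of concatenations of arbitrary words, so
  that cancellation can be carried out inside a list.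
\<close>

definition winv :: "'a word \<Rightarrow> 'a word" where
  "winv w = rev (map (\<lambda>(a, b). (a, \<not> b)) w)"

definition nf :: "'a word \<Rightarrow> 'a word" where
  "nf w = foldr push w []"

lemma winv_simps [simp]:
  "winv [] = []"
  "winv ((a, b) # w) = winv w @ [(a, \<not> b)]"
  "winv (u @ v) = winv v @ winv u"
  "winv (winv w) = w"
  "winv w = [] \<longleftrightarrow> w = []"
  "fst ` set (winv w) = fst ` set w"
  by (auto simp: winv_def rev_map o_def case_prod_unfold image_image)

lemma reduced_winv: "reduced w \<Longrightarrow> reduced (winv w)"
  by (simp add: winv_def reduced_inverse)

lemma reduced_append:
  "reduced (u @ v) \<longleftrightarrow>
    reduced u \<and> reduced v \<and> (u = [] \<or> v = [] \<or> \<not> cancels (last u) (hd v))"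
  by (auto simp: reduced_def successively_append_iff)

lemma reduced_nf [simp]: "reduced (nf w)"
  by (simp add: nf_def reduced_foldr_push)

lemma nf_reduced: "reduced w \<Longrightarrow> nf w = w"
  by (simp add: nf_def foldr_push_Nil)

lemma set_nf: "set (nf w) \<subseteq> set w"
  using set_foldr_push[of w "[]"] by (simp add: nf_def)

lemma length_nf: "length (nf w) \<le> length w"
proof (induction w)
  case (Cons p w)
  have "length (push p v) \<le> Suc (length v)" for v by (cases v) auto
  then show ?case using Cons by (simp add: nf_def) (meson Suc_le_mono order_trans)
qed (simp add: nf_def)

lemma foldr_push_nf: "foldr push u (nf v) = nf (u @ v)"
  by (simp add: nf_def)

lemma nf_append_nf: "nf (u @ nf v) = nf (u @ v)"
  by (simp flip: foldr_push_nf add: nf_reduced)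

lemma nf_nf_append: "nf (nf u @ v) = nf (u @ v)"
proof -
  have "foldr push (foldr push u []) (nf v) = foldr push u (foldr push [] (nf v))"
    by (rule foldr_push_assoc) simp
  then show ?thesis by (simp flip: foldr_push_nf add: nf_def)
qed

lemma nf_winv_cancel: "nf (u @ winv s @ s @ v) = nf (u @ v)"
  using foldr_push_inverse[of "nf v" s]
  by (simp flip: foldr_push_nf winv_def)

lemma nf_cancel_winv: "nf (u @ s @ winv s @ v) = nf (u @ v)"
  using nf_winv_cancel[of u "winv s" v] by simp

lemma nf_cancel_letters: "cancels p q \<Longrightarrow> nf (u @ p # q # v) = nf (u @ v)"
  using push_cancel[OF reduced_nf, of p q v] by (simp add: nf_def)

text \<open>
  This replaces the statement that \<open>winv\<close> commutes with \<open>nf\<close>: both \<open>winv (nf u)\<close> and \<open>winv u\<close>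
  stand for the inverse of the element that \<open>u\<close> stands for.
\<close>

lemma nf_winv_nf: "nf (winv (nf u) @ w) = nf (winv u @ w)"
proof -
  have "nf (winv (nf u) @ w) = nf (winv (nf u) @ nf (u @ winv u @ w))"
    using nf_cancel_winv[of "[]" u w] nf_append_nf[of "winv (nf u)" w] by simp
  also have "\<dots> = nf (winv (nf u) @ nf u @ winv u @ w)"
    using nf_append_nf[of "winv (nf u)" "nf u @ winv u @ w"] by (simp add: nf_nf_append)
  also have "\<dots> = nf (winv u @ w)"
    using nf_winv_cancel[of "[]" "nf u"] by simp
  finally show ?thesis .
qed

lemma free_group_carrier:
  "w \<in> carrier (free_group S) \<longleftrightarrow> fst ` set w \<subseteq> S \<and> reduced w"
  by (simp add: free_group_def)

lemma free_group_mult: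
  "v \<in> carrier (free_group S) \<Longrightarrow> u \<otimes>\<^bsub>free_group S\<^esub> v = nf (u @ v)"
  using foldr_push_nf[of u v] by (simp add: free_group_def nf_reduced)

lemma free_group_inv:
  assumes "u \<in> carrier (free_group S)"
  shows "inv\<^bsub>free_group S\<^esub> u = winv u"
proof (rule group.inv_equality[OF group_free_group _ assms])
  show "winv u \<otimes>\<^bsub>free_group S\<^esub> u = \<one>\<^bsub>free_group S\<^esub>"
    using nf_winv_cancel[of "[]" u "[]"] assms by (simp add: free_group_mult)
      (simp add: free_group_def nf_def)
  show "winv u \<in> carrier (free_group S)"
    using assms by (simp add: free_group_carrier reduced_winv)
qed

lemma free_group_conj_gen:
  assumes "f \<in> carrier (free_group S)" "a \<in> S"
  shows "inv\<^bsub>free_group S\<^esub> f \<otimes>\<^bsub>free_group S\<^esub> gen a \<otimes>\<^bsub>free_group S\<^esub> f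
    = nf (winv f @ (a, True) # f)"
  using assms gen_closed[OF assms(2)] nf_nf_append[of "winv f @ gen a" f]
  by (simp add: free_group_mult free_group_inv) (simp add: gen_def)

section \<open>Generators of the group of basis conjugating automorphisms\<close>

text \<open>
  The unreduced image of a word under the endomorphism that conjugates each generator \<open>a\<close> by \<open>f a\<close>.
  The letter \<open>p\<close> itself, with its sign, is the central letter of its factor, since
  the inverse of a conjugate is the conjugate of the inverse by the same element.
\<close>

definition conj_subst :: "('a \<Rightarrow> 'a word) \<Rightarrow> 'a word \<Rightarrow> 'a word" where
  "conj_subst f w = concat (map (\<lambda>p. winv (f (fst p)) @ p # f (fst p)) w)"

lemma conj_subst_simps [simp]:
  "conj_subst f [] = []"
  "conj_subst f (p # w) = winv (f (fst p)) @ p # f (fst p) @ conj_subst f w"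
  by (simp_all add: conj_subst_def)

lemma hom_conj_subst:
  assumes \<phi>: "\<phi> \<in> hom (free_group S) (free_group S)"
    and gen: "\<And>a. a \<in> S \<Longrightarrow> \<phi> (gen a) = nf (winv (f a) @ (a, True) # f a)"
    and f: "\<And>a. a \<in> S \<Longrightarrow> f a \<in> carrier (free_group S)"
    and w: "w \<in> carrier (free_group S)"
  shows "\<phi> w = nf (conj_subst f w)"
proof -
  interpret group "free_group S" by (rule group_free_group)
  interpret \<phi>: group_hom "free_group S" "free_group S" \<phi> using \<phi> by unfold_locales
  have letter: "\<phi> [p] = nf (winv (f (fst p)) @ p # f (fst p))" if "fst p \<in> S" for p
  proof (cases p)
    case (Pair a b)
    have a: "a \<in> S" using that Pair by simp
    show ?thesis
    proof (cases b)
      case True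
      then show ?thesis using gen[OF a] by (simp add: Pair gen_def)
    next
      case False
      let ?F = "free_group S" and ?A = "[(a, False)]"
      have fa: "f a \<in> carrier ?F" using f[OF a] .
      have inv: "?A = inv\<^bsub>?F\<^esub> (gen a)" by (simp add: inv_gen a)
      have "\<phi> ?A = inv\<^bsub>?F\<^esub> (inv\<^bsub>?F\<^esub> (f a) \<otimes>\<^bsub>?F\<^esub> gen a \<otimes>\<^bsub>?F\<^esub> f a)"
        by (simp only: inv \<phi>.hom_inv[OF gen_closed[OF a]] gen[OF a] free_group_conj_gen[OF fa a])
      also have "\<dots> = inv\<^bsub>?F\<^esub> (f a) \<otimes>\<^bsub>?F\<^esub> ?A \<otimes>\<^bsub>?F\<^esub> f a"
        using fa gen_closed[OF a] by (simp add: inv inv_mult_group m_assoc)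
      also have "\<dots> = nf (winv (f a) @ (a, False) # f a)"
        using fa a nf_nf_append[of "winv (f a) @ ?A" "f a"]
        by (simp add: free_group_mult free_group_inv[OF fa] free_group_carrier reduced_Cons)
      finally show ?thesis by (simp add: Pair False)
    qed
  qed
  show ?thesis using w
  proof (induction w)
    case Nil
    show ?case using \<phi>.hom_one by (simp add: free_group_def nf_def)
  next
    case (Cons p w)
    have p: "fst p \<in> S" "[p] \<in> carrier (free_group S)" and w: "w \<in> carrier (free_group S)"
      using Cons.prems by (auto simp: free_group_carrier reduced_Cons)
    have "p # w = [p] \<otimes>\<^bsub>free_group S\<^esub> w"
      using Cons.prems w by (simp add: free_group_mult nf_reduced free_group_carrier)
    then have "\<phi> (p # w) = \<phi> [p] \<otimes>\<^bsub>free_group S\<^esub> \<phi> w"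
      using p w by simp
    also have "\<dots> = nf (nf (winv (f (fst p)) @ p # f (fst p)) @ nf (conj_subst f w))"
      using letter[OF p(1)] Cons.IH[OF w] \<phi>.hom_closed[OF w] by (simp add: free_group_mult)
    finally show ?case by (simp add: nf_append_nf nf_nf_append)
  qed
qed

lemma common_suffix:
  obtains p q s where "u = p @ s" "v = q @ s" "p = [] \<or> q = [] \<or> last p \<noteq> last q"
proof -
  have "\<exists>p q s. u = p @ s \<and> v = q @ s \<and> (p = [] \<or> q = [] \<or> last p \<noteq> last q)"
  proof (induction u arbitrary: v rule: rev_induct)
    case (snoc x u)
    show ?case
    proof (cases v rule: rev_cases)
      case (snoc v' y)
      show ?thesis
      proof (cases "x = y")
        case True
        then obtain p q s where "u = p @ s" "v' = q @ s" "p = [] \<or> q = [] \<or> last p \<noteq> last q"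
          using snoc.IH by blast
        then show ?thesis using snoc True
          by (intro exI[of _ p] exI[of _ q] exI[of _ "s @ [x]"]) auto
      next
        case False
        then show ?thesis using snoc
          by (intro exI[of _ "u @ [x]"] exI[of _ v] exI[of _ "[]"]) auto
      qed
    qed auto
  qed auto
  then show thesis using that by blast
qed

text \<open>
  Between two consecutive central letters \<open>p\<close> and \<open>p'\<close>, over generators \<open>i \<noteq> j\<close>, stands
  \<open>f i @ winv (f j)\<close>. After removal of the longest common suffix of \<open>f i\<close> and \<open>f j\<close> it is reduced,
  and it could only cancel against \<open>p\<close> or \<open>p'\<close> if one of \<open>f i\<close>, \<open>f j\<close> ended with the other one
  preceded by a letter over the generator of that other one, which \<open>absorb\<close> excludes. The conclusion
  keeps only the beginning of the normal form: it is enough for the induction, where a new factor meets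
  precisely that part, and it determines the first letter of \<open>w\<close> when the value is a single letter.
\<close>

lemma central_letters_survive:
  assumes red: "\<And>i. i \<in> S \<Longrightarrow> reduced (f i)"
    and start: "\<And>i b g. i \<in> S \<Longrightarrow> f i \<noteq> (i, b) # g"
    and absorb: "\<And>i j a q. i \<in> S \<Longrightarrow> j \<in> S \<Longrightarrow> i \<noteq> j \<Longrightarrow> f j \<noteq> q @ (i, a) # f i"
    and w: "w \<noteq> []" "reduced w" "fst ` set w \<subseteq> S"
  shows "\<exists>r. nf (conj_subst f w) = winv (f (fst (hd w))) @ hd w # r"
  using w
proof (induction w)
  case (Cons p w)
  obtain i b where p: "p = (i, b)" by force
  have i: "i \<in> S" using Cons.prems p by simp
  have hd: "f i = [] \<or> fst (hd (f i)) \<noteq> i"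
    using start[OF i, of "snd (hd (f i))" "tl (f i)"] by (cases "f i") auto
  have pf: "reduced (p # f i)"
    using hd red[OF i] by (auto simp: reduced_Cons cancels_def p)
  have fp: "reduced (winv (f i) @ [p])"
    using hd reduced_winv[OF red[OF i]]
    by (cases "f i") (auto simp: reduced_append reduced_Cons cancels_def p)
  have glue: "reduced (winv (f i) @ p # v)" if "reduced (p # v)" for v
    using fp that by (auto simp: reduced_append reduced_Cons)
  show ?case
  proof (cases w)
    case Nil
    have "nf (winv (f i) @ p # f i) = winv (f i) @ p # f i"
      by (rule nf_reduced) (rule glue[OF pf])
    then show ?thesis using Nil p by simp
  next
    case (Cons p' w')
    obtain j c where p': "p' = (j, c)" by force
    have j: "j \<in> S" using Cons.prems p' Cons by simp
    obtain r where r: "nf (conj_subst f w) = winv (f j) @ p' # r"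
      using Cons.IH Cons.prems Cons p' by (auto simp: reduced_Cons)
    have red': "reduced (winv (f j) @ p' # r)" by (simp flip: r)
    have eq: "nf (conj_subst f (p # w)) = nf (winv (f i) @ p # f i @ winv (f j) @ p' # r)"
      using nf_append_nf[of "winv (f i) @ p # f i" "conj_subst f w"] p by (simp add: r)
    have npp': "\<not> cancels p p'" using Cons.prems Cons by (simp add: reduced_Cons)
    have "\<exists>v. nf (winv (f i) @ p # f i @ winv (f j) @ p' # r) = winv (f i) @ p # v @ p' # r"
    proof (cases "i = j")
      case True
      have "nf (winv (f i) @ p # f i @ winv (f j) @ p' # r) = nf (winv (f i) @ p # p' # r)"
        using nf_cancel_winv[of "winv (f i) @ [p]" "f i" "p' # r"] True by simp
      also have "\<dots> = winv (f i) @ p # p' # r"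
        using red' npp' by (intro nf_reduced glue) (auto simp: reduced_append reduced_Cons)
      finally show ?thesis by (intro exI[of _ "[]"]) simp
    next
      case False
      obtain u v s where u: "f i = u @ s" and v: "f j = v @ s"
        and uv: "u = [] \<or> v = [] \<or> last u \<noteq> last v"
        by (rule common_suffix)
      have "nf (winv (f i) @ p # f i @ winv (f j) @ p' # r)
          = nf (winv (f i) @ p # u @ winv v @ p' # r)"
        using nf_cancel_winv[of "winv (f i) @ p # u" s "winv v @ p' # r"] by (simp add: u v)
      also have "\<dots> = winv (f i) @ p # u @ winv v @ p' # r"
      proof (intro nf_reduced glue)
        have pu: "reduced (p # u)" using pf u by (auto simp: reduced_Cons reduced_append)
        have vr: "reduced (winv v @ p' # r)" using red' v by (auto simp: reduced_append)
        show "reduced (p # u @ winv v @ p' # r)"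
        proof (cases u rule: rev_cases)
          case Nil
          show ?thesis
          proof (cases v rule: rev_cases)
            case Nil
            then show ?thesis using \<open>u = []\<close> vr npp' by (simp add: reduced_Cons)
          next
            case (snoc q x)
            have "fst x \<noteq> i"
              using absorb[OF i j False, of q "snd x"] u v \<open>u = []\<close> snoc by (cases x) auto
            then show ?thesis using \<open>u = []\<close> vr snoc
              by (cases x) (auto simp: reduced_Cons cancels_def p)
          qed
        next
          case (snoc q x)
          have "\<not> cancels x (hd (winv v @ p' # r))"
          proof (cases v rule: rev_cases)
            case Nil
            have "fst x \<noteq> j"
              using absorb[OF j i, of q "snd x"] False u v Nil snoc by (cases x) auto
            then show ?thesis using Nil by (simp add: cancels_def p')
          next
            case (snoc q' y)
            then show ?thesis using uv \<open>u = q @ [x]\<close>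
              by (cases x; cases y) (auto simp: cancels_def)
          qed
          then show ?thesis using pu vr snoc
            by (auto simp: reduced_append simp flip: append_Cons)
        qed
      qed
      finally show ?thesis by (intro exI[of _ "u @ winv v"]) simp
    qed
    then obtain v where "nf (conj_subst f (p # w)) = winv (f i) @ p # v @ p' # r"
      using eq by auto
    then show ?thesis using p by auto
  qed
qed simp


abbreviation eps_set :: "nat \<Rightarrow> (nat word \<Rightarrow> nat word) set" where
  "eps_set n \<equiv> {eps n i j | i j. i < n \<and> j < n \<and> i \<noteq> j}"

lemma eps_set_subset: "eps_set n \<subseteq> carrier (Cb n)"
  by (auto intro: eps_in_Cb)

lemma Cb_eqI:
  assumes "\<phi> \<in> carrier (Cb n)" "\<psi> \<in> carrier (Cb n)" "\<And>i. i < n \<Longrightarrow> \<phi> (gen i) = \<psi> (gen i)"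
  shows "\<phi> = \<psi>"
proof (rule extensionalityI)
  show "\<phi> \<in> extensional (carrier (Fn n))" "\<psi> \<in> extensional (carrier (Fn n))"
    using assms by (auto simp: carrier_Cb Bij_def)
  show "\<phi> w = \<psi> w" if "w \<in> carrier (Fn n)" for w
    using assms that
    by (intro group.hom_free_group_eqI[OF group_free_group, of \<phi> "{..<n}" _ \<psi> w])
       (auto simp: carrier_Cb)
qed

lemma one_Cb: "w \<in> carrier (Fn n) \<Longrightarrow> \<one>\<^bsub>Cb n\<^esub> w = w"
  by (simp add: Cb_def AutoGroup_def BijGroup_def)

lemma Cb_mult_gen:
  assumes "\<phi> \<in> carrier (Cb n)" "\<psi> \<in> carrier (Cb n)" "i < n"
  shows "(\<phi> \<otimes>\<^bsub>Cb n\<^esub> \<psi>) (gen i) = \<phi> (\<psi> (gen i))"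
  using assms by (simp add: mult_Cb compose_eq gen_closed)

text \<open>
  The two signs \<open>a\<close> correspond to the inverse of \<open>eps n j i\<close> and to \<open>eps n j i\<close> itself, so that both
  kinds of absorbed letters can be treated at once.
\<close>

lemma conj_by_letter_in_generate:
  assumes ij: "i < n" "j < n" "i \<noteq> j"
  shows "\<exists>\<psi>\<in>generate (Cb n) (eps_set n). \<psi> (gen j) = [(i, a), (j, True), (i, \<not> a)] \<and>
    (\<forall>l<n. l \<noteq> j \<longrightarrow> \<psi> (gen l) = gen l)"
proof -
  interpret F: group "Fn n" by (rule group_free_group)
  interpret C: group "Cb n" by (rule group_Cb)
  have gi: "gen i \<in> carrier (Fn n)" and gj: "gen j \<in> carrier (Fn n)"
    using ij by (auto intro: gen_closed)
  let ?e = "eps n j i"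
  have e: "?e \<in> eps_set n" using ij by auto
  have eC: "?e \<in> carrier (Cb n)" using eps_set_subset e by blast
  show ?thesis
  proof (cases a)
    case False
    have "?e (gen j) = nf (winv (gen i) @ (j, True) # gen i)"
      using ij by (simp add: eps_gen free_group_conj_gen gi)
    also have "\<dots> = [(i, a), (j, True), (i, \<not> a)]"
      using ij False by (simp add: gen_def nf_reduced reduced_Cons cancels_def)
    finally show ?thesis using ij e
      by (intro bexI[of _ ?e]) (auto simp: eps_gen intro: generate.incl)
  next
    case True
    define \<psi> where "\<psi> = inv\<^bsub>Cb n\<^esub> ?e"
    have \<psi>C: "\<psi> \<in> carrier (Cb n)" using eC by (simp add: \<psi>_def)
    then interpret \<psi>: group_hom "Fn n" "Fn n" \<psi> by unfold_locales (simp add: carrier_Cb)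
    have "\<psi> \<otimes>\<^bsub>Cb n\<^esub> ?e = \<one>\<^bsub>Cb n\<^esub>" using eC by (simp add: \<psi>_def)
    then have \<psi>e: "\<psi> (?e (gen l)) = gen l" if "l < n" for l
      using that Cb_mult_gen[OF \<psi>C eC that] by (simp add: one_Cb gen_closed)
    have fix_gen: "\<psi> (gen l) = gen l" if "l < n" "l \<noteq> j" for l
      using \<psi>e[of l] that ij by (simp add: eps_gen)
    have "gen j = inv\<^bsub>Fn n\<^esub> (gen i) \<otimes>\<^bsub>Fn n\<^esub> \<psi> (gen j) \<otimes>\<^bsub>Fn n\<^esub> gen i"
      using \<psi>e[of j] ij fix_gen[of i] gi gj by (simp add: eps_gen)
    then have "\<psi> (gen j) = gen i \<otimes>\<^bsub>Fn n\<^esub> gen j \<otimes>\<^bsub>Fn n\<^esub> inv\<^bsub>Fn n\<^esub> (gen i)"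
      using gi gj
      by (metis \<psi>.hom_closed F.inv_closed F.inv_solve_left F.inv_solve_right F.m_assoc F.m_closed)
    also have "\<dots> = nf ([(i, True), (j, True)] @ [(i, False)])"
      using gi gj ij nf_nf_append[of "[(i, True), (j, True)]" "[(i, False)]"]
      by (simp add: free_group_mult inv_gen free_group_carrier reduced_Cons) (simp add: gen_def)
    also have "\<dots> = [(i, a), (j, True), (i, \<not> a)]"
      using ij True by (simp add: nf_reduced reduced_Cons cancels_def)
    finally show ?thesis using e fix_gen
      by (intro bexI[of _ \<psi>]) (auto simp: \<psi>_def intro: generate.inv)
  qed
qed

text \<open>
  The conjugators are an explicit part of the data and need not be the shortest ones: a leading
  letter over \<open>i\<close> in \<open>f i\<close> commutes with the generator \<open>i\<close> and is stripped off, which also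
  reduces the total length on which the induction runs.
\<close>

lemma in_generate_if_conjugators:
  assumes "\<phi> \<in> carrier (Cb n)"
    and "\<forall>i<n. f i \<in> carrier (Fn n) \<and> \<phi> (gen i) = nf (winv (f i) @ (i, True) # f i)"
  shows "\<phi> \<in> generate (Cb n) (eps_set n)"
  using assms
proof (induction "\<Sum>i<n. length (f i)" arbitrary: \<phi> f rule: less_induct)
  case less
  interpret C: group "Cb n" by (rule group_Cb)
  have \<phi>: "\<phi> \<in> carrier (Cb n)" using less.prems by simp
  have fc: "f i \<in> carrier (Fn n)"
    and \<phi>gen: "\<phi> (gen i) = nf (winv (f i) @ (i, True) # f i)" if "i < n" for i
    using less.prems(2) that by auto
  have shorter: "(\<Sum>i<n. length ((f(j := g)) i)) < (\<Sum>i<n. length (f i))"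
    if "j < n" "length g < length (f j)" for j g
    using that by (intro sum_strict_mono_ex1) auto
  have subst: "\<phi> w = nf (conj_subst f w)" if "w \<in> carrier (Fn n)" for w
    using \<phi> that \<phi>gen fc by (intro hom_conj_subst[of \<phi> "{..<n}"]) (auto simp: carrier_Cb)
  consider (strip) i b g where "i < n" "f i = (i, b) # g"
    | (absorb) i j a q where "i < n" "j < n" "i \<noteq> j" "f j = q @ (i, a) # f i"
    | (survive) "\<And>i b g. i < n \<Longrightarrow> f i \<noteq> (i, b) # g"
        "\<And>i j a q. i < n \<Longrightarrow> j < n \<Longrightarrow> i \<noteq> j \<Longrightarrow> f j \<noteq> q @ (i, a) # f i"
    by blast
  then show ?case
  proof cases
    case strip
    have "\<phi> (gen i) = nf (winv g @ (i, True) # g)"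
      using \<phi>gen[OF strip(1)] nf_cancel_letters[of "(i, True)" "(i, False)" "winv g @ [(i, True)]" g]
        nf_cancel_letters[of "(i, True)" "(i, False)" "winv g" "(i, True) # g"]
        nf_cancel_letters[of "(i, False)" "(i, True)" "winv g" "(i, True) # g"]
      by (cases b) (simp_all add: strip cancels_def)
    moreover have "g \<in> carrier (Fn n)"
      using fc[OF strip(1)] strip by (auto simp: free_group_carrier reduced_Cons)
    ultimately show ?thesis
      using shorter[of i g] strip \<phi> fc \<phi>gen
      by (intro less.hyps[of "f(i := g)"]) auto
  next
    case absorb
    note ij = absorb(1-3)
    obtain \<psi> where \<psi>: "\<psi> \<in> generate (Cb n) (eps_set n)"
      and \<psi>j: "\<psi> (gen j) = [(i, a), (j, True), (i, \<not> a)]"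
      and \<psi>l: "\<And>l. l < n \<Longrightarrow> l \<noteq> j \<Longrightarrow> \<psi> (gen l) = gen l"
      using conj_by_letter_in_generate[OF ij, of a] by blast
    have \<psi>C: "\<psi> \<in> carrier (Cb n)"
      using C.generate_in_carrier[OF eps_set_subset \<psi>] .
    \<comment> \<open>Conjugating the image of generator \<open>j\<close> by that of generator \<open>i\<close> cancels the letter \<open>(i, a)\<close>.\<close>
    define g where "g = nf (q @ f i)"
    have "\<phi> (\<psi> (gen j)) = nf (conj_subst f [(i, a), (j, True), (i, \<not> a)])"
      using ij by (simp add: \<psi>j subst free_group_carrier reduced_Cons cancels_def)
    also have "\<dots> = nf (winv (f i) @ (i, a) # f i @ winv (f i) @ (i, \<not> a) # winv q @ (j, True) #
        q @ (i, a) # f i @ winv (f i) @ (i, \<not> a) # f i)"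
      by (simp add: absorb(4))
    also have "\<dots> = nf (winv (f i) @ (i, a) # (i, \<not> a) # winv q @ (j, True) #
        q @ (i, a) # (i, \<not> a) # f i)"
      using nf_cancel_winv[of "winv (f i) @ [(i, a)]" "f i"]
        nf_cancel_winv[of "winv (f i) @ (i, a) # (i, \<not> a) # winv q @ (j, True) # q @ [(i, a)]" "f i"]
      by simp
    also have "\<dots> = nf (winv (f i) @ winv q @ (j, True) # q @ f i)"
      using nf_cancel_letters[of "(i, a)" "(i, \<not> a)" "winv (f i)"]
        nf_cancel_letters[of "(i, a)" "(i, \<not> a)" "winv (f i) @ winv q @ (j, True) # q"]
      by (simp add: cancels_def)
    also have "\<dots> = nf (winv g @ (j, True) # g)"
    proof -
      have "nf (winv g @ (j, True) # g) = nf (winv g @ (j, True) # q @ f i)"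
        using nf_append_nf[of "winv g @ [(j, True)]" "q @ f i"] by (simp add: g_def)
      also have "\<dots> = nf (winv (f i) @ winv q @ (j, True) # q @ f i)"
        using nf_winv_nf[of "q @ f i"] by (simp add: g_def)
      finally show ?thesis ..
    qed
    finally have "\<phi> (\<psi> (gen j)) = nf (winv g @ (j, True) # g)" .
    moreover have "g \<in> carrier (Fn n)"
      using fc[OF ij(2)] set_nf[of "q @ f i"]
      by (fastforce simp: g_def free_group_carrier absorb(4))
    moreover have "length g < length (f j)"
      using length_nf[of "q @ f i"] by (simp add: g_def absorb(4))
    moreover have "\<phi> \<otimes>\<^bsub>Cb n\<^esub> \<psi> \<in> carrier (Cb n)" using \<phi> \<psi>C by simp
    ultimately have "\<phi> \<otimes>\<^bsub>Cb n\<^esub> \<psi> \<in> generate (Cb n) (eps_set n)"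
      using shorter[OF ij(2), of g] \<phi> \<psi>C fc \<phi>gen
      by (intro less.hyps[of "f(j := g)"]) (auto simp: Cb_mult_gen \<psi>l)
    then have "(\<phi> \<otimes>\<^bsub>Cb n\<^esub> \<psi>) \<otimes>\<^bsub>Cb n\<^esub> inv\<^bsub>Cb n\<^esub> \<psi> \<in> generate (Cb n) (eps_set n)"
      using \<psi> C.generate_m_inv_closed[OF eps_set_subset] by (blast intro: generate.eng)
    then show ?thesis using \<phi> \<psi>C by (simp add: C.m_assoc)
  next
    case survive
    have f_Nil: "f i = []" if i: "i < n" for i
    proof -
      have "gen i \<in> \<phi> ` carrier (Fn n)"
        using \<phi> i by (auto simp: carrier_Cb Bij_def bij_betw_def intro: gen_closed)
      then obtain w where w: "w \<in> carrier (Fn n)" "\<phi> w = gen i" by auto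
      have gen: "nf (conj_subst f w) = [(i, True)]"
        using subst[OF w(1)] w(2) by (simp add: gen_def)
      then have "w \<noteq> []" by (auto simp: nf_def)
      then obtain r where r: "[(i, True)] = winv (f (fst (hd w))) @ hd w # r"
        using central_letters_survive[of "{..<n}" f w] survive fc w
        by (auto simp: free_group_carrier gen)
      have "winv (f (fst (hd w))) = [] \<and> hd w = (i, True)"
        using r by (cases "winv (f (fst (hd w)))") (simp_all del: winv_simps)
      then show ?thesis by force
    qed
    have "\<phi> = \<one>\<^bsub>Cb n\<^esub>"
    proof (rule Cb_eqI[OF \<phi> C.one_closed])
      fix i assume i: "i < n"
      have "\<phi> (gen i) = gen i"
        using \<phi>gen[OF i] f_Nil[OF i] by (simp add: nf_reduced reduced_Cons gen_def)
      then show "\<phi> (gen i) = \<one>\<^bsub>Cb n\<^esub> (gen i)" using i by (simp add: one_Cb gen_closed)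
    qed
    then show ?thesis by (simp add: generate.one)
  qed
qed

text \<open>McCool's theorem.\<close>

theorem Cb_generated_by_eps: "generate (Cb n) (eps_set n) = carrier (Cb n)"
proof
  interpret C: group "Cb n" by (rule group_Cb)
  show "generate (Cb n) (eps_set n) \<subseteq> carrier (Cb n)"
    using C.generate_in_carrier[OF eps_set_subset] by blast
  show "carrier (Cb n) \<subseteq> generate (Cb n) (eps_set n)"
  proof
    fix \<phi> assume \<phi>: "\<phi> \<in> carrier (Cb n)"
    then have "\<forall>i<n. \<exists>f. f \<in> carrier (Fn n) \<and> \<phi> (gen i) = nf (winv f @ (i, True) # f)"
      by (fastforce simp: carrier_Cb free_group_conj_gen)
    then obtain f where
      "\<forall>i<n. f i \<in> carrier (Fn n) \<and> \<phi> (gen i) = nf (winv (f i) @ (i, True) # f i)"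
      by metis
    then show "\<phi> \<in> generate (Cb n) (eps_set n)"
      using \<phi> by (rule in_generate_if_conjugators[rotated])
  qed
qed


section \<open>The invariant hyperplane\<close>

lemma GL_simps:
  "A \<in> carrier (GL d) \<Longrightarrow> A \<in> carrier_mat d d"
  "A \<otimes>\<^bsub>GL d\<^esub> B = A * B"
  "\<one>\<^bsub>GL d\<^esub> = 1\<^sub>m d"
  by (auto simp: units_of_def Units_def ring_mat_def)

lemma group_GL: "group (GL d)"
proof -
  interpret semiring "ring_mat TYPE(complex) d ()" by (rule semiring_mat)
  show ?thesis by (rule units_group)
qed

lemma mult_mat_vec_nth:
  "\<lbrakk>A \<in> carrier_mat d d; w \<in> carrier_vec d; r < d\<rbrakk> \<Longrightarrow>
    (A *\<^sub>v w) $ r = (\<Sum>k<d. A $$ (r, k) * w $ k)"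
  by (simp add: scalar_prod_def lessThan_atLeast0)

lemma mult_diagonal_row:
  fixes A B :: "complex mat"
  assumes "A \<in> carrier_mat n n" "B \<in> carrier_mat n n" "i < n" "c < n"
    and "\<forall>k<n. k \<noteq> i \<longrightarrow> A $$ (i, k) = 0"
  shows "(A * B) $$ (i, c) = A $$ (i, i) * B $$ (i, c)"
proof -
  have "(A * B) $$ (i, c) = (\<Sum>k<n. A $$ (i, k) * B $$ (k, c))"
    using assms by (simp add: scalar_prod_def lessThan_atLeast0)
  also have "\<dots> = (\<Sum>k<n. if k = i then A $$ (i, i) * B $$ (i, c) else 0)"
    using assms by (intro sum.cong) auto
  finally show ?thesis using assms by simp
qed

text \<open>
  For an invertible matrix, having an \<open>i\<close>-th row that vanishes off the diagonal means preserving the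
  hyperplane of vectors with vanishing \<open>i\<close>-th coordinate. So it suffices to look at the generators.
\<close>

lemma diagonal_row_Cb:
  assumes \<rho>: "\<rho> \<in> hom (Cb n) (GL n)"
    and eps: "\<forall>i<n. \<forall>j<n. i \<noteq> j \<longrightarrow> \<rho> (eps n i j) = gassner_mat n t i j"
    and i: "i < n" "t i = 1" and g: "g \<in> carrier (Cb n)" and c: "c < n" "c \<noteq> i"
  shows "\<rho> g $$ (i, c) = 0"
proof -
  interpret C: group "Cb n" by (rule group_Cb)
  interpret \<rho>: group_hom "Cb n" "GL n" \<rho>
    using \<rho> group_Cb group_GL by (simp add: group_hom_def group_hom_axioms_def)
  have mat: "\<rho> h \<in> carrier_mat n n" if "h \<in> carrier (Cb n)" for h
    using \<rho>.hom_closed[OF that] by (rule GL_simps)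
  have eps_row: "\<forall>c<n. c \<noteq> i \<longrightarrow> \<rho> h $$ (i, c) = 0" if "h \<in> eps_set n" for h
    using that eps i by (auto simp: gassner_mat_def)
  have "g \<in> generate (Cb n) (eps_set n)" using g by (simp add: Cb_generated_by_eps)
  then have "\<forall>c<n. c \<noteq> i \<longrightarrow> \<rho> g $$ (i, c) = 0"
  proof induction
    case one
    then show ?case using i \<rho>.hom_one by (simp add: GL_simps)
  next
    case (incl h)
    then show ?case by (rule eps_row)
  next
    case (inv h)
    then have h: "h \<in> carrier (Cb n)" using eps_set_subset by blast
    have "\<rho> h * \<rho> (inv\<^bsub>Cb n\<^esub> h) = 1\<^sub>m n"
      using \<rho>.hom_mult[of h "inv\<^bsub>Cb n\<^esub> h"] h by (simp add: GL_simps del: \<rho>.hom_inv)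
    then have prod: "\<rho> h $$ (i, i) * \<rho> (inv\<^bsub>Cb n\<^esub> h) $$ (i, c) = 1\<^sub>m n $$ (i, c)" if "c < n" for c
      using mult_diagonal_row[OF mat[OF h] mat[OF C.inv_closed[OF h]] i(1) that eps_row[OF inv]]
      by simp
    from prod[OF i(1)] have "\<rho> h $$ (i, i) \<noteq> 0" using i by auto
    then show ?case using prod i by (metis index_one_mat(1) mult_eq_0_iff)
  next
    case (eng h1 h2)
    have h: "h1 \<in> carrier (Cb n)" "h2 \<in> carrier (Cb n)"
      using eng.hyps by (simp_all add: Cb_generated_by_eps)
    have "\<rho> (h1 \<otimes>\<^bsub>Cb n\<^esub> h2) = \<rho> h1 * \<rho> h2" using h by (simp add: GL_simps)
    then show ?case using mult_diagonal_row[OF mat mat i(1) _ eng.IH(1)] h eng.IH(2) by simp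
  qed
  then show ?thesis using c by simp
qed

lemma factor_carrier: "gassner_factor n t \<rho> g \<in> carrier_mat (n - 1) (n - 1)"
  by (rule carrier_matI) (simp_all add: gassner_factor_def)

section \<open>Irreducibility\<close>

lemma subspace_iff:
  "subspace class_ring W (module_vec TYPE(complex) d) \<longleftrightarrow>
    W \<subseteq> carrier_vec d \<and> 0\<^sub>v d \<in> W \<and> (\<forall>u\<in>W. \<forall>v\<in>W. u + v \<in> W) \<and> (\<forall>c. \<forall>v\<in>W. c \<cdot>\<^sub>v v \<in> W)"
  using vec_vs[of d] vec_module[of d]
  by (auto simp: subspace_def LinearCombinations.submodule_def class_ring_simps module_vec_simps)

text \<open>
  A vector is assembled from its coordinates one at a time, through the truncations that keep its
  first \<open>m\<close> coordinates.
\<close>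

lemma carrier_vec_if_unit_vecs:
  assumes W: "subspace class_ring W (module_vec TYPE(complex) d)"
    and unit: "\<And>k. k < d \<Longrightarrow> unit_vec d k \<in> W"
  shows "W = carrier_vec d"
proof
  show "W \<subseteq> carrier_vec d" using W by (simp add: subspace_iff)
  show "carrier_vec d \<subseteq> W"
  proof
    fix w :: "complex vec" assume w: "w \<in> carrier_vec d"
    have "vec d (\<lambda>k. if k < m then w $ k else 0) \<in> W" if "m \<le> d" for m
      using that
    proof (induction m)
      case 0
      have "vec d (\<lambda>k. if k < 0 then w $ k else 0) = 0\<^sub>v d" by auto
      then show ?case using W by (simp add: subspace_iff)
    next
      case (Suc m)
      have "vec d (\<lambda>k. if k < Suc m then w $ k else 0)
          = vec d (\<lambda>k. if k < m then w $ k else 0) + w $ m \<cdot>\<^sub>v unit_vec d m"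
        using Suc.prems by (intro eq_vecI) (auto simp: unit_vec_def less_Suc_eq)
      then show ?case using W Suc unit[of m] by (simp add: subspace_iff)
    qed
    from this[of d] have "vec d (\<lambda>k. if k < d then w $ k else 0) \<in> W" by simp
    moreover have "vec d (\<lambda>k. if k < d then w $ k else 0) = w" using w by auto
    ultimately show "w \<in> W" by simp
  qed
qed

theorem theorem4:
  fixes n :: nat and t :: "nat \<Rightarrow> complex"
    and \<rho> :: "(nat word \<Rightarrow> nat word) \<Rightarrow> complex mat"
  assumes "n \<ge> 1" and "n \<noteq> 2"
    and "\<forall>i<n. t i \<noteq> 0"
    and "t (n - 1) \<noteq> 1"
    and "\<rho> \<in> hom (Cb n) (GL n)"
    and "\<forall>i<n. \<forall>j<n. i \<noteq> j \<longrightarrow> \<rho> (eps n i j) = gassner_mat n t i j"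
  shows "irreducible_rep (Cb n) (n - 1) (gassner_factor n t \<rho>) \<longleftrightarrow> (\<forall>i<n - 1. t i \<noteq> 1)"
proof
  assume irr: "irreducible_rep (Cb n) (n - 1) (gassner_factor n t \<rho>)"
  show "\<forall>i<n - 1. t i \<noteq> 1"
  proof (intro allI impI notI)
    fix i assume i: "i < n - 1" "t i = 1"
    define W :: "complex vec set" where "W = {w \<in> carrier_vec (n - 1). w $ i = 0}"
    have "subspace class_ring W (module_vec TYPE(complex) (n - 1))"
      using i by (auto simp: subspace_iff W_def)
    moreover have "gassner_factor n t \<rho> g *\<^sub>v w \<in> W" if "g \<in> carrier (Cb n)" "w \<in> W" for g w
    proof -
      let ?A = "gassner_factor n t \<rho> g"
      have \<rho>g: "\<rho> g \<in> carrier_mat n n"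
        using assms(5) that by (auto simp: hom_def intro: GL_simps)
      have "?A $$ (i, c) = 0" if c: "c < n - 1" "c \<noteq> i" for c
        using diagonal_row_Cb[OF assms(5,6) _ i(2) \<open>g \<in> carrier (Cb n)\<close>, of c] c i
        by (simp add: gassner_factor_index[where \<rho> = \<rho>, OF refl \<rho>g])
      moreover have "w $ i = 0" "w \<in> carrier_vec (n - 1)" using that by (auto simp: W_def)
      ultimately have "?A $$ (i, k) * w $ k = 0" if "k < n - 1" for k
        using that by (cases "k = i") auto
      then have "(\<Sum>k<n - 1. ?A $$ (i, k) * w $ k) = 0" by (intro sum.neutral) auto
      then have "(?A *\<^sub>v w) $ i = 0"
        by (simp only: mult_mat_vec_nth[OF factor_carrier \<open>w \<in> carrier_vec (n - 1)\<close> i(1)])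
      then show ?thesis
        using mult_mat_vec_carrier[OF factor_carrier \<open>w \<in> carrier_vec (n - 1)\<close>]
        by (simp add: W_def)
    qed
    ultimately have "W = {0\<^sub>v (n - 1)} \<or> W = carrier_vec (n - 1)"
      using irr by (simp add: irreducible_rep_def)
    moreover have "unit_vec (n - 1) i \<notin> W" "unit_vec (n - 1) i \<in> carrier_vec (n - 1)"
      using i by (simp_all add: W_def)
    \<comment> \<open>A second coordinate exists because \<open>n > 2\<close>; it shows that the hyperplane is not zero.\<close>
    moreover obtain k where k: "k < n - 1" "k \<noteq> i"
      by (rule that[of "if i = 0 then 1 else 0"]) (use i assms(2) in \<open>auto split: if_splits\<close>)
    then have "unit_vec (n - 1) k \<in> W" "unit_vec (n - 1) k \<noteq> (0\<^sub>v (n - 1) :: complex vec)"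
      using i by (simp_all add: W_def)
    ultimately show False by blast
  qed
next
  assume t: "\<forall>i<n - 1. t i \<noteq> 1"
  show "irreducible_rep (Cb n) (n - 1) (gassner_factor n t \<rho>)"
    unfolding irreducible_rep_def
  proof (intro allI impI)
    fix W assume W: "subspace class_ring W (module_vec TYPE(complex) (n - 1))"
      and inv: "\<forall>g\<in>carrier (Cb n). \<forall>w\<in>W. gassner_factor n t \<rho> g *\<^sub>v w \<in> W"
    note sub = W[unfolded subspace_iff]
    let ?d = "n - 1" and ?A = "\<lambda>i j. gassner_factor n t \<rho> (eps n i j)"
    have inv': "?A i j *\<^sub>v w \<in> W" if "w \<in> W" "i < n" "j < n" "i \<noteq> j" for w i j
      using inv that by (auto intro: eps_in_Cb)
    have entry: "?A i j $$ (r, c) =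
      (if r = i then
        (if c = i then inverse (t j) else if c = j then inverse (t j) * (t i - 1) else 0)
       else if r = c then 1 else 0)"
      if "i < ?d" "j < n" "i \<noteq> j" "r < ?d" "c < ?d" for i j r c
    proof (cases "j < ?d")
      case False
      then have "j = ?d" using that by simp
      then show ?thesis using that assms gassner_factor_eps[of i n ?d t \<rho> r c] by auto
    qed (use that assms gassner_factor_eps[of i n j t \<rho> r c] in auto)
    have unit_if_scaled: "unit_vec ?d i \<in> W" if "x \<cdot>\<^sub>v unit_vec ?d i \<in> W" "x \<noteq> 0" for x i
    proof -
      have "inverse x \<cdot>\<^sub>v (x \<cdot>\<^sub>v unit_vec ?d i) \<in> W" using that sub by blast
      then show ?thesis using that by (simp add: smult_smult_assoc)
    qed
    have diff: "u - w \<in> W" if "u \<in> W" "w \<in> W" for u w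
    proof -
      have "u + (-1) \<cdot>\<^sub>v w \<in> W" using sub that by blast
      moreover have "u + (-1) \<cdot>\<^sub>v w = u - w"
        using sub that by (intro eq_vecI) auto
      ultimately show ?thesis by simp
    qed
    \<comment> \<open>\<open>eps n i ?d - 1\<close> is a nonzero multiple of the projection onto the \<open>i\<close>-th coordinate axis.\<close>
    have unit_of_coord: "unit_vec ?d i \<in> W" if w: "w \<in> W" and i: "i < ?d" "w $ i \<noteq> 0" for w i
    proof (rule unit_if_scaled)
      let ?x = "(inverse (t ?d) - 1) * w $ i"
      have wc: "w \<in> carrier_vec ?d" using w sub by blast
      have "?A i ?d *\<^sub>v w - w = ?x \<cdot>\<^sub>v unit_vec ?d i"
      proof (rule eq_vecI)
        fix r assume "r < dim_vec (?x \<cdot>\<^sub>v unit_vec ?d i)"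
        then have r: "r < ?d" by simp
        have "(?A i ?d *\<^sub>v w) $ r = (\<Sum>k<?d. ?A i ?d $$ (r, k) * w $ k)"
          by (rule mult_mat_vec_nth[OF factor_carrier wc r])
        also have "\<dots> = (\<Sum>k<?d. if k = r then (if r = i then inverse (t ?d) else 1) * w $ r else 0)"
          using r i by (intro sum.cong) (auto simp: entry)
        finally show "(?A i ?d *\<^sub>v w - w) $ r = (?x \<cdot>\<^sub>v unit_vec ?d i) $ r"
          using r i wc by (simp add: algebra_simps)
      qed (use wc in simp)
      moreover have "?A i ?d *\<^sub>v w - w \<in> W" using w i by (intro diff inv') auto
      ultimately show "?x \<cdot>\<^sub>v unit_vec ?d i \<in> W" by simp
      show "?x \<noteq> 0" using i assms(4) by simp
    qed
    have unit_of_unit: "unit_vec ?d j \<in> W" if i: "unit_vec ?d i \<in> W" "i < ?d" and j: "j < ?d" "j \<noteq> i" for i j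
    proof (rule unit_of_coord[OF _ j(1)])
      show "?A j i *\<^sub>v unit_vec ?d i \<in> W" using i j by (intro inv') auto
      have "(?A j i *\<^sub>v unit_vec ?d i) $ j = ?A j i $$ (j, i)"
        using i j factor_carrier[of n t \<rho> "eps n j i"] by simp
      also have "\<dots> = inverse (t i) * (t j - 1)" using i j by (simp add: entry)
      finally show "(?A j i *\<^sub>v unit_vec ?d i) $ j \<noteq> 0" using i j t assms(3) by simp
    qed
    show "W = {0\<^sub>v ?d} \<or> W = carrier_vec ?d"
    proof (rule disjCI)
      assume "W \<noteq> carrier_vec ?d"
      then obtain k where k: "k < ?d" "unit_vec ?d k \<notin> W"
        using carrier_vec_if_unit_vecs[OF W] by blast
      then have "unit_vec ?d i \<notin> W" if "i < ?d" for i
        using unit_of_unit[of i k] that by (cases "i = k") auto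
      then have "w = 0\<^sub>v ?d" if "w \<in> W" for w
        using unit_of_coord[OF that] that sub by (intro eq_vecI) auto
      then show "W = {0\<^sub>v ?d}" using sub by auto
    qed
  qed
qed

end
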